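(* Let $d\geq 0$ and $0<i\leq d+1$ be integers such that $i$ divides $d+1$. Let $\Delta\in\mathcal{C}(i,d)$. Then $f_j(\Delta)\geq f_j(S(i,d))$ for every $j$.
   Context: All simplicial complexes are finite abstract simplicial complexes; $f_j(\Delta)$ denotes the number of $j$-dimensional faces (faces with $j+1$ vertices) of $\Delta$. A set $F$ of vertices is a missing face of $\Delta$ if $F\notin\Delta$ but every proper subset of $F$ is in $\Delta$; its dimension is $|F|-1$. $\mathcal{C}(i,d)$ denotes the family of $d$-dimensional simplicial complexes $\Delta$ with $\tilde H_d(\Delta;\mathbb{Z})\neq 0$ (reduced homology) and with no missing faces of dimension $>i$. For integers $d\geq 0$, $i>0$ let $q\geq 0$ and $1\leq r\leq i$ be the unique integers with $d+1=qi+r$, and let $S(i,d)=\partial\sigma^i*\cdots*\partial\sigma^i*\partial\sigma^r$ (the simplicial join of $q$ copies of $\partial\sigma^i$ and one copy of $\partial\sigma^r$), where $\partial\sigma^k$ denotes the boundary complex of the $k$-simplex (all proper subsets of a $(k+1)$-element vertex set), the factors being on pairwise disjoint vertex sets. $S(i,d)$ is a $d$-dimensional simplicial sphere. *)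

theory Defs
  imports Main
begin

definition simplicial_complex :: "'a set set \<Rightarrow> bool" where
  "simplicial_complex K \<longleftrightarrow> finite K \<and> (\<forall>F\<in>K. finite F) \<and> (\<forall>F\<in>K. \<forall>G. G \<subseteq> F \<longrightarrow> G \<in> K)"

definition has_dim :: "'a set set \<Rightarrow> nat \<Rightarrow> bool" where
  "has_dim K d \<longleftrightarrow> (\<exists>F\<in>K. card F = d + 1) \<and> (\<forall>F\<in>K. card F \<le> d + 1)"

definition fvec :: "nat \<Rightarrow> 'a set set \<Rightarrow> nat" where
  "fvec j K = card {F \<in> K. card F = j + 1}"

definition missing_face :: "'a set set \<Rightarrow> 'a set \<Rightarrow> bool" where
  "missing_face K F \<longleftrightarrow> finite F \<and> F \<notin> K \<and> (\<forall>G. G \<subset> F \<longrightarrow> G \<in> K)"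

(* Simplicial chains with integer coefficients: a k-chain is a function on faces,
   supported on the k-dimensional faces.  Faces are oriented by the vertex order. *)
definition is_chain :: "'a set set \<Rightarrow> nat \<Rightarrow> ('a set \<Rightarrow> int) \<Rightarrow> bool" where
  "is_chain K k c \<longleftrightarrow> (\<forall>F. c F \<noteq> 0 \<longrightarrow> F \<in> K \<and> card F = k + 1)"

(* Simplicial boundary map (of the augmented chain complex, the empty face spanning C_{-1}):
   the coefficient of G in the boundary of c is the sum over faces F = G + {v} of
   (-1)^(position of v in F) * c F. *)
definition bd :: "'a::linorder set set \<Rightarrow> ('a set \<Rightarrow> int) \<Rightarrow> 'a set \<Rightarrow> int" where
  "bd K c G = (\<Sum>v\<in>{v. v \<notin> G \<and> insert v G \<in> K}. (-1) ^ card {u \<in> G. u < v} * c (insert v G))"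

definition reduced_homology_nonzero :: "'a::linorder set set \<Rightarrow> nat \<Rightarrow> bool" where
  "reduced_homology_nonzero K k \<longleftrightarrow>
     (\<exists>c. is_chain K k c \<and> (\<forall>G. bd K c G = 0) \<and>
          \<not> (\<exists>b. is_chain K (k + 1) b \<and> bd K b = c))"

definition Cfam :: "nat \<Rightarrow> nat \<Rightarrow> 'a::linorder set set set" where
  "Cfam i d = {K. simplicial_complex K \<and> has_dim K d \<and> reduced_homology_nonzero K d \<and>
                  (\<forall>F. missing_face K F \<longrightarrow> card F - 1 \<le> i)}"

definition bdry_simplex :: "'a set \<Rightarrow> 'a set set" where
  "bdry_simplex V = {F. F \<subset> V}"

definition join :: "'a set set \<Rightarrow> 'a set set \<Rightarrow> 'a set set" where
  "join K L = {A \<union> B | A B. A \<in> K \<and> B \<in> L}"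

(* S(i,d): with d+1 = q*i + r, 1 <= r <= i (so q = d div i, r = d mod i + 1),
   join of q copies of the boundary of the i-simplex and one boundary of the r-simplex,
   on the pairwise disjoint vertex blocks {t(i+1), ..., t(i+1)+i} (t < q) and
   {q(i+1), ..., q(i+1)+r}. *)
definition S_sphere :: "nat \<Rightarrow> nat \<Rightarrow> nat set set" where
  "S_sphere i d =
     (let q = d div i; r = d mod i + 1 in
      foldr join (map (\<lambda>t. bdry_simplex {t * (i + 1) ..< t * (i + 1) + (i + 1)}) [0..<q])
                 (bdry_simplex {q * (i + 1) ..< q * (i + 1) + (r + 1)}))"

end

theory Submission
  imports Defs "HOL-Computational_Algebra.Polynomial"
begin

text \<open>
  Of a nonzero cycle only its support \<open>Z\<close> matters: for \<open>F \<in> Z\<close> and \<open>v \<in> F\<close> some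
  \<open>F - v + w\<close> with \<open>w \<notin> F\<close> lies in \<open>Z\<close> again. This property passes to links of faces below \<open>Z\<close>.
  Let \<open>g n = (1+x)^(n+1) - x^(n+1)\<close> be the face polynomial of the boundary of the \<open>n\<close>-simplex, and
  let \<open>B\<close> bound from below the face polynomials of the complexes of dimension \<open>e\<close> without missing
  faces of dimension \<open>> i\<close>. By induction
  on \<open>n \<le> i\<close>, the face polynomial of a complex \<open>K\<close> of dimension \<open>e + n\<close> without missing faces of
  dimension \<open>> n\<close> is at least \<open>g n * B\<close>, coefficientwise; \<open>n = i\<close> is the induction step of the theorem.
  Faces with at most \<open>n + 1\<close> vertices that are not below \<open>Z\<close> can be deleted, so assume there are none.
  If \<open>M\<close> is a missing face with \<open>n + 1\<close> vertices, then for \<open>A \<subset> M\<close> and \<open>v \<in> M - A\<close> each face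
  of the link of \<open>M - v\<close> gives a face of \<open>K\<close> that meets \<open>M\<close> in \<open>A\<close>; sum over \<open>A\<close>.
  Otherwise some vertex \<open>v\<close> lies in a missing face of at most \<open>n\<close> vertices; enlarge the rest of it
  to \<open>H\<close> below \<open>Z\<close> with \<open>n\<close> vertices, \<open>v \<notin> H\<close>. The faces avoiding \<open>v\<close> include the join of the simplex
  \<open>H\<close> with its link, those containing \<open>v\<close> form the link of \<open>v\<close>, and
  \<open>g n = (1+x)^n + x * g (n-1)\<close>.
\<close>

section \<open>Face polynomials\<close>

text \<open>With natural coefficients, multiplication by any fixed polynomial is monotone for this
  order.\<close>

definition coeff_le :: "nat poly \<Rightarrow> nat poly \<Rightarrow> bool" where
  "coeff_le p q \<longleftrightarrow> (\<forall>k. coeff p k \<le> coeff q k)"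

lemma coeff_le_trans [trans]: "coeff_le p q \<Longrightarrow> coeff_le q r \<Longrightarrow> coeff_le p r"
  unfolding coeff_le_def using order_trans by blast

lemma coeff_le_add: "coeff_le p p' \<Longrightarrow> coeff_le q q' \<Longrightarrow> coeff_le (p + q) (p' + q')"
  by (simp add: coeff_le_def add_mono)

lemma coeff_le_mult_left: "coeff_le p q \<Longrightarrow> coeff_le (r * p) (r * q)"
  by (auto simp: coeff_le_def coeff_mult intro!: sum_mono mult_le_mono)

lemma coeff_le_sum: "(\<And>x. x \<in> A \<Longrightarrow> coeff_le (p x) (q x)) \<Longrightarrow> coeff_le (sum p A) (sum q A)"
  by (auto simp: coeff_le_def coeff_sum intro!: sum_mono)

text \<open>Graded by the number of vertices: the empty face gives the constant term, f_j is the
  coefficient of x^(j+1), and joins become products.\<close>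

definition face_poly :: "'a set set \<Rightarrow> nat poly" where
  "face_poly K = (\<Sum>F\<in>K. monom 1 (card F))"

lemma coeff_face_poly:
  assumes "finite K"
  shows "coeff (face_poly K) k = card {F \<in> K. card F = k}"
  using assms by (simp add: face_poly_def coeff_sum sum.If_cases Collect_conj_eq Int_commute)

lemma face_poly_mono: "finite K \<Longrightarrow> L \<subseteq> K \<Longrightarrow> coeff_le (face_poly L) (face_poly K)"
  by (auto simp: coeff_le_def coeff_face_poly finite_subset intro!: card_mono)

lemma face_poly_Un_disjoint:
  "finite K \<Longrightarrow> finite L \<Longrightarrow> K \<inter> L = {} \<Longrightarrow> face_poly (K \<union> L) = face_poly K + face_poly L"
  by (simp add: face_poly_def sum.union_disjoint)

lemma face_poly_singleton [simp]: "face_poly {A} = monom 1 (card A)"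
  by (simp add: face_poly_def)

section \<open>Joins and full simplices\<close>

lemma join_conv_image: "join K L = (\<lambda>(A, B). A \<union> B) ` (K \<times> L)"
  by (auto simp: join_def)

lemma finite_join: "finite K \<Longrightarrow> finite L \<Longrightarrow> finite (join K L)"
  by (simp add: join_conv_image)

text \<open>Intersecting a union with either vertex set recovers the corresponding part, so distinct
  pairs give distinct unions, and cardinalities add.\<close>

lemma face_poly_join:
  assumes fin: "\<forall>A\<in>K. finite A" "\<forall>B\<in>L. finite B" and disj: "\<Union>K \<inter> \<Union>L = {}"
  shows "face_poly (join K L) = face_poly K * face_poly L"
proof -
  have "inj_on (\<lambda>(A, B). A \<union> B) (K \<times> L)"
  proof (rule inj_onI, clarify)
    fix A B A' B'
    assume *: "A \<in> K" "B \<in> L" "A' \<in> K" "B' \<in> L" "A \<union> B = A' \<union> B'"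
    have "A = (A \<union> B) \<inter> \<Union>K" "A' = (A' \<union> B') \<inter> \<Union>K"
         "B = (A \<union> B) \<inter> \<Union>L" "B' = (A' \<union> B') \<inter> \<Union>L" using * disj by blast+
    then show "A = A' \<and> B = B'" using * by metis
  qed
  then have "face_poly (join K L) = (\<Sum>(A, B)\<in>K \<times> L. monom 1 (card (A \<union> B)))"
    by (simp add: face_poly_def join_conv_image sum.reindex case_prod_unfold)
  also have "\<dots> = (\<Sum>(A, B)\<in>K \<times> L. monom 1 (card A) * monom 1 (card B))"
  proof (rule sum.cong, simp, clarify)
    fix A B assume *: "A \<in> K" "B \<in> L"
    then have "A \<inter> B = {}" using disj by blast
    then show "monom 1 (card (A \<union> B)) = (monom 1 (card A) * monom 1 (card B) :: nat poly)"
      using * fin by (simp add: card_Un_disjoint mult_monom)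
  qed
  also have "\<dots> = face_poly K * face_poly L"
    by (simp add: face_poly_def sum_product sum.cartesian_product)
  finally show ?thesis .
qed

lemma face_poly_Pow:
  assumes "finite V"
  shows "face_poly (Pow V) = [:1, 1:] ^ card V"
  using assms
proof (induction V)
  case empty
  then show ?case by (simp add: face_poly_def monom_0 one_pCons)
next
  case (insert v V)
  have "Pow (insert v V) = join {{}, {v}} (Pow V)"
    by (auto simp: join_def Pow_insert)
  moreover have "face_poly {{}, {v}} = [:1, 1:]"
    by (simp add: face_poly_def monom_0 monom_Suc)
  moreover have "face_poly (join {{}, {v}} (Pow V)) = face_poly {{}, {v}} * face_poly (Pow V)"
    using insert by (intro face_poly_join) (auto intro: finite_subset)
  ultimately show ?case using insert by simp
qed

section \<open>Boundaries of simplices and the sphere S(i,d)\<close>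

primrec simplex_boundary_poly :: "nat \<Rightarrow> nat poly" where
  "simplex_boundary_poly 0 = 1"
| "simplex_boundary_poly (Suc n) = [:1, 1:] ^ Suc n + monom 1 1 * simplex_boundary_poly n"

text \<open>Ties the recursion, shaped like the vertex split in the induction step, to (1+x)^(n+1) -
  x^(n+1). The additive form avoids truncated subtraction.\<close>

lemma simplex_boundary_poly_plus:
  "simplex_boundary_poly n + monom 1 (Suc n) = [:1, 1:] ^ Suc n"
proof (induction n)
  case 0
  then show ?case by (simp add: monom_Suc monom_0 one_pCons)
next
  case (Suc n)
  have "simplex_boundary_poly (Suc n) + monom 1 (Suc (Suc n))
      = [:1, 1:] ^ Suc n + monom 1 1 * (simplex_boundary_poly n + monom 1 (Suc n))"
    by (simp add: distrib_left mult_monom add.assoc del: power_Suc)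
  also have "\<dots> = (1 + monom 1 1) * [:1, 1:] ^ Suc n"
    unfolding Suc by (simp add: distrib_right del: power_Suc)
  also have "1 + monom 1 1 = ([:1, 1:] :: nat poly)"
    by (simp add: monom_Suc monom_0 one_pCons)
  finally show ?case by simp
qed

lemma finite_bdry_simplex: "finite V \<Longrightarrow> finite (bdry_simplex V)"
  by (rule finite_subset[of _ "Pow V"]) (auto simp: bdry_simplex_def)

lemma finite_in_bdry_simplex: "A \<in> bdry_simplex V \<Longrightarrow> finite V \<Longrightarrow> finite A"
  by (auto simp: bdry_simplex_def intro: finite_subset)

lemma face_poly_bdry_simplex:
  assumes "finite V" "card V = Suc n"
  shows "face_poly (bdry_simplex V) = simplex_boundary_poly n"
proof -
  have "Pow V = bdry_simplex V \<union> {V}" by (auto simp: bdry_simplex_def)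
  moreover have "finite (bdry_simplex V)"
    using assms by (simp add: finite_bdry_simplex)
  moreover have "bdry_simplex V \<inter> {V} = {}" by (auto simp: bdry_simplex_def)
  ultimately have "face_poly (bdry_simplex V) + monom 1 (Suc n) = [:1, 1:] ^ Suc n"
    using face_poly_Un_disjoint[of "bdry_simplex V" "{V}"] face_poly_Pow[OF assms(1)] assms(2)
    by (simp del: Un_insert_right power_Suc One_nat_def)
  then show ?thesis using simplex_boundary_poly_plus[of n] by (metis add_right_cancel)
qed

text \<open>\<open>foldr\<close> joins the last block to \<open>L\<close> first, so the induction
  absorbs that block into \<open>L\<close>. Hence \<open>L\<close> is arbitrary, lying beyond all q
  blocks to keep the vertex sets disjoint.\<close>

lemma face_poly_foldr_join:
  fixes L :: "nat set set"
  assumes "\<forall>B\<in>L. finite B \<and> B \<subseteq> {q * (i + 1)..}"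
  shows "face_poly (foldr join (map (\<lambda>t. bdry_simplex {t * (i + 1) ..< t * (i + 1) + (i + 1)}) [0..<q]) L)
       = simplex_boundary_poly i ^ q * face_poly L"
  using assms
proof (induction q arbitrary: L)
  case 0
  then show ?case by simp
next
  case (Suc q)
  let ?V = "{q * (i + 1) ..< q * (i + 1) + (i + 1)}"
  let ?L = "join (bdry_simplex ?V) L"
  have fin: "\<forall>A\<in>bdry_simplex ?V. finite A"
    by (auto intro: finite_in_bdry_simplex)
  have "\<forall>B\<in>?L. finite B \<and> B \<subseteq> {q * (i + 1)..}"
  proof
    fix B assume "B \<in> ?L"
    then obtain A C where B: "B = A \<union> C" and A: "A \<in> bdry_simplex ?V" and C: "C \<in> L"
      by (auto simp: join_def)
    have "?V \<subseteq> {q * (i + 1)..}" by auto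
    then have "finite A" "A \<subseteq> {q * (i + 1)..}"
      using A fin unfolding bdry_simplex_def by blast+
    moreover have "finite C" "C \<subseteq> {Suc q * (i + 1)..}"
      using C Suc.prems by blast+
    moreover have "{Suc q * (i + 1)..} \<subseteq> {q * (i + 1)..}" by auto
    ultimately show "finite B \<and> B \<subseteq> {q * (i + 1)..}"
      unfolding B by (metis Un_subset_iff finite_Un order_trans)
  qed
  moreover have "face_poly ?L = face_poly (bdry_simplex ?V) * face_poly L"
  proof (rule face_poly_join)
    have "\<Union>(bdry_simplex ?V) \<subseteq> {..<Suc q * (i + 1)}" by (auto simp: bdry_simplex_def)
    moreover have "\<Union>L \<subseteq> {Suc q * (i + 1)..}" using Suc.prems by blast
    moreover have "{..<Suc q * (i + 1)} \<inter> {Suc q * (i + 1)..} = {}" by auto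
    ultimately show "\<Union>(bdry_simplex ?V) \<inter> \<Union>L = {}" by blast
  qed (use Suc.prems fin in auto)
  moreover have "face_poly (bdry_simplex ?V) = simplex_boundary_poly i"
    by (intro face_poly_bdry_simplex) auto
  ultimately show ?case using Suc.IH[of ?L] by (simp add: mult.assoc mult.commute mult.left_commute)
qed

lemma face_poly_S_sphere:
  assumes "0 < i" "d + 1 = m * i"
  shows "face_poly (S_sphere i d) = simplex_boundary_poly i ^ m"
proof -
  obtain q where m: "m = Suc q" using assms by (cases m) auto
  obtain j where j: "i = Suc j" using assms(1) by (cases i) auto
  \<comment> \<open>d + 1 = (q + 1) * i forces d mod i = i - 1, so r = i: the last factor of the
    join is like the q others, which makes m equal factors.\<close>
  have d: "d = j + q * i" and "j < i" using assms m j by simp_all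
  have q: "d div i = q"
    using \<open>j < i\<close> unfolding d by (subst div_mult_self1) auto
  have r: "d mod i + 1 = i"
    using \<open>j < i\<close> unfolding d by (subst mod_mult_self1) (simp add: j)
  let ?V = "{q * (i + 1) ..< q * (i + 1) + (i + 1)}"
  have "\<forall>B\<in>bdry_simplex ?V. finite B \<and> B \<subseteq> {q * (i + 1)..}"
    by (auto intro: finite_in_bdry_simplex) (auto simp: bdry_simplex_def)
  moreover have "face_poly (bdry_simplex ?V) = simplex_boundary_poly i"
    by (intro face_poly_bdry_simplex) auto
  ultimately show ?thesis
    unfolding S_sphere_def Let_def q r m by (simp only: face_poly_foldr_join power_Suc2)
qed

lemma finite_S_sphere: "finite (S_sphere i d)"
proof -
  have fin: "finite (foldr join (map (\<lambda>t. bdry_simplex {f t ..< f t + k}) ts) L)" if "finite L"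
    for f :: "nat \<Rightarrow> nat" and k L and ts :: "nat list"
    by (induction ts) (use that in \<open>simp_all add: finite_join finite_bdry_simplex\<close>)
  show ?thesis
    unfolding S_sphere_def Let_def by (rule fin) (simp add: finite_bdry_simplex)
qed

section \<open>Supports of cycles, links and deletions\<close>

text \<open>Each ridge below a member lies in a second member. Signs and coefficients are forgotten,
  so passing to links needs no chain computation.\<close>

definition closed_family :: "nat \<Rightarrow> 'a set set \<Rightarrow> bool" where
  "closed_family D Z \<longleftrightarrow> Z \<noteq> {} \<and>
     (\<forall>F\<in>Z. card F = D \<and> (\<forall>v\<in>F. \<exists>w. w \<notin> F \<and> insert w (F - {v}) \<in> Z))"

text \<open>Here \<open>D\<close> counts vertices: it is the dimension plus one, so that dimension \<open>-1\<close> is covered.\<close>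

definition supports_cycle :: "nat \<Rightarrow> nat \<Rightarrow> 'a set set \<Rightarrow> 'a set set \<Rightarrow> bool" where
  "supports_cycle n D K Z \<longleftrightarrow> simplicial_complex K \<and> (\<forall>F\<in>K. card F \<le> D) \<and>
     (\<forall>F. missing_face K F \<longrightarrow> card F \<le> n + 1) \<and> Z \<subseteq> K \<and> closed_family D Z"

lemma supports_cycle_mono: "supports_cycle n D K Z \<Longrightarrow> n \<le> n' \<Longrightarrow> supports_cycle n' D K Z"
  by (fastforce simp: supports_cycle_def)

lemma nonface_contains_missing_face:
  assumes "finite F" "F \<notin> K"
  obtains M where "M \<subseteq> F" "missing_face K M"
proof -
  have "finite {M. M \<subseteq> F \<and> M \<notin> K}" "{M. M \<subseteq> F \<and> M \<notin> K} \<noteq> {}" using assms by auto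
  then obtain M where M: "M \<subseteq> F" "M \<notin> K" and
    min: "\<And>G. G \<subseteq> F \<Longrightarrow> G \<notin> K \<Longrightarrow> G \<subseteq> M \<Longrightarrow> M = G"
    using finite_has_minimal[of "{M. M \<subseteq> F \<and> M \<notin> K}"] by auto
  have "missing_face K M"
    unfolding missing_face_def using M min assms(1) finite_subset
    by (metis order_trans psubset_eq)
  with M that show thesis by blast
qed

section \<open>Links and deletions\<close>

definition link :: "'a set set \<Rightarrow> 'a set \<Rightarrow> 'a set set" where
  "link K A = {F. F \<inter> A = {} \<and> F \<union> A \<in> K}"

lemma link_subset: "simplicial_complex K \<Longrightarrow> link K A \<subseteq> K"
  unfolding link_def simplicial_complex_def by blast

lemma simplicial_complex_link: "simplicial_complex K \<Longrightarrow> simplicial_complex (link K A)"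
proof -
  assume K: "simplicial_complex K"
  have "finite (link K A)" "\<forall>F\<in>link K A. finite F"
    using K link_subset[OF K] by (auto simp: simplicial_complex_def intro: finite_subset)
  moreover have "G \<in> link K A" if "F \<in> link K A" "G \<subseteq> F" for F G
  proof -
    have "G \<union> A \<subseteq> F \<union> A" "F \<union> A \<in> K" "F \<inter> A = {}" using that by (auto simp: link_def)
    then show ?thesis using K that by (auto simp: link_def simplicial_complex_def)
  qed
  ultimately show ?thesis by (auto simp: simplicial_complex_def)
qed

text \<open>If F is disjoint from A, then F \<union> A contains a missing face of K. This must
  contain all of F, because F - f together with A is a face for every f in F.\<close>

lemma card_missing_face_link_le:
  assumes K: "simplicial_complex K" and A: "A \<in> K" and F: "missing_face (link K A) F"
    and bound: "\<forall>M. missing_face K M \<longrightarrow> card M \<le> n + 1"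
  shows "card F \<le> n + 1"
proof (cases "F \<inter> A = {}")
  case True
  have fin: "finite (F \<union> A)" using K A F by (auto simp: simplicial_complex_def missing_face_def)
  have "F \<union> A \<notin> K" using F True by (auto simp: missing_face_def link_def)
  then obtain M where M: "M \<subseteq> F \<union> A" "missing_face K M"
    using nonface_contains_missing_face[OF fin] by blast
  have "F \<subseteq> M"
  proof
    fix f assume f: "f \<in> F"
    show "f \<in> M"
    proof (rule ccontr)
      assume "f \<notin> M"
      then have "M \<subseteq> (F - {f}) \<union> A" using M(1) by blast
      moreover have "F - {f} \<subset> F" using f by blast
      then have "(F - {f}) \<union> A \<in> K" using F by (simp add: missing_face_def link_def)
      ultimately have "M \<in> K" using K by (auto simp: simplicial_complex_def)
      then show False using M(2) by (simp add: missing_face_def)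
    qed
  qed
  then have "card F \<le> card M" using M fin finite_subset card_mono by metis
  then show ?thesis using bound M(2) by fastforce
next
  case False
  then obtain a where a: "a \<in> F" "a \<in> A" by blast
  \<comment> \<open>A vertex of A is not a vertex of the link, so the singleton is already a nonface
    there.\<close>
  have "F = {a}"
  proof (rule ccontr)
    assume "F \<noteq> {a}"
    then have "{a} \<in> link K A" using F a by (auto simp: missing_face_def)
    then show False using a by (auto simp: link_def)
  qed
  then show ?thesis by simp
qed

text \<open>Exchanging a vertex v of F - A leaves A inside the new member, since v is not in
  A.\<close>

lemma closed_family_link:
  assumes Z: "closed_family D Z" "\<forall>F\<in>Z. finite F" and A: "A \<subseteq> F\<^sub>0" "F\<^sub>0 \<in> Z"
  shows "closed_family (D - card A) {F - A | F. F \<in> Z \<and> A \<subseteq> F}"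
  unfolding closed_family_def
proof (intro conjI ballI)
  show "{F - A | F. F \<in> Z \<and> A \<subseteq> F} \<noteq> {}" using A by blast
next
  fix G assume "G \<in> {F - A | F. F \<in> Z \<and> A \<subseteq> F}"
  then obtain F where F: "G = F - A" "F \<in> Z" "A \<subseteq> F" by blast
  then show "card G = D - card A"
    using Z by (simp add: closed_family_def card_Diff_subset finite_subset)
  fix v assume v: "v \<in> G"
  then obtain w where w: "w \<notin> F" "insert w (F - {v}) \<in> Z"
    using F Z unfolding closed_family_def by blast
  have "insert w (G - {v}) = insert w (F - {v}) - A" "A \<subseteq> insert w (F - {v})"
    using F v w by blast+
  then show "\<exists>w. w \<notin> G \<and> insert w (G - {v}) \<in> {F - A | F. F \<in> Z \<and> A \<subseteq> F}"
    using w F by blast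
qed

lemma supports_cycle_link:
  assumes K: "supports_cycle n D K Z" and A: "A \<subseteq> F" "F \<in> Z"
  shows "\<exists>Z'. supports_cycle n (D - card A) (link K A) Z'"
proof -
  have sc: "simplicial_complex K" and ZK: "Z \<subseteq> K" using K by (auto simp: supports_cycle_def)
  then have finK: "\<forall>F\<in>K. finite F" by (simp add: simplicial_complex_def)
  have AK: "A \<in> K" using sc ZK A by (auto simp: simplicial_complex_def)
  let ?Z = "{F - A | F. F \<in> Z \<and> A \<subseteq> F}"
  have "card G \<le> D - card A" if G: "G \<in> link K A" for G
  proof -
    have "G \<union> A \<in> K" "G \<inter> A = {}" using G by (auto simp: link_def)
    moreover have "finite G" "finite A" using finK calculation by auto
    ultimately have "card G + card A \<le> D"
      using K by (metis supports_cycle_def card_Un_disjoint)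
    then show ?thesis by simp
  qed
  moreover have "?Z \<subseteq> link K A"
    using ZK by (auto simp: link_def Un_absorb2)
  moreover have "closed_family (D - card A) ?Z"
    using K finK ZK A by (intro closed_family_link) (auto simp: supports_cycle_def)
  moreover have "\<forall>F. missing_face (link K A) F \<longrightarrow> card F \<le> n + 1"
    using K AK by (auto intro!: card_missing_face_link_le[OF sc AK, simplified] simp: supports_cycle_def)
  ultimately have "supports_cycle n (D - card A) (link K A) ?Z"
    using simplicial_complex_link[OF sc] by (simp add: supports_cycle_def)
  then show ?thesis by blast
qed

text \<open>The only missing face that deletion can create is T itself: a deleted face contains T,
  and a minimal one equals T.\<close>

lemma supports_cycle_deletion:
  assumes K: "supports_cycle n D K Z" and T: "card T \<le> n + 1" "\<forall>F\<in>Z. \<not> T \<subseteq> F"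
  shows "supports_cycle n D {F \<in> K. \<not> T \<subseteq> F} Z"
proof -
  let ?K = "{F \<in> K. \<not> T \<subseteq> F}"
  have "simplicial_complex ?K" using K by (auto simp: supports_cycle_def simplicial_complex_def)
  moreover have "card M \<le> n + 1" if M: "missing_face ?K M" for M
  proof (cases "M \<in> K")
    case True
    then have "T \<subseteq> M" using M by (auto simp: missing_face_def)
    moreover have "\<not> T \<subset> M" using M by (auto simp: missing_face_def)
    ultimately show ?thesis using T by auto
  next
    case False
    then have "missing_face K M" using M by (auto simp: missing_face_def)
    then show ?thesis using K by (auto simp: supports_cycle_def)
  qed
  ultimately show ?thesis using K T by (auto simp: supports_cycle_def)
qed

text \<open>Z is the support of a cycle. The boundary coefficient at F - v vanishes but contains the
  nonzero term of F, so another face over F - v has a nonzero coefficient.\<close>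

lemma nonzero_homology_closed_family:
  assumes K: "simplicial_complex K" and "reduced_homology_nonzero K d"
  obtains Z where "Z \<subseteq> K" "closed_family (d + 1) Z"
proof -
  obtain c where c: "is_chain K d c" "\<And>G. bd K c G = 0"
    and nb: "\<not> (\<exists>b. is_chain K (d + 1) b \<and> bd K b = c)"
    using assms(2) by (auto simp: reduced_homology_nonzero_def)
  define Z where "Z = {F. c F \<noteq> 0}"
  \<comment> \<open>The zero chain bounds; nothing more is needed from c not being a
    boundary.\<close>
  have "c \<noteq> (\<lambda>_. 0)"
  proof
    assume "c = (\<lambda>_. 0)"
    then have "is_chain K (d + 1) (\<lambda>_. 0) \<and> bd K (\<lambda>_. 0) = c"
      by (auto simp: is_chain_def bd_def)
    then show False using nb by blast
  qed
  then have "Z \<noteq> {}" by (auto simp: Z_def)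
  moreover have ZK: "Z \<subseteq> K" and cardZ: "\<forall>F\<in>Z. card F = d + 1"
    using c(1) by (auto simp: Z_def is_chain_def)
  moreover have "\<exists>w. w \<notin> F \<and> insert w (F - {v}) \<in> Z" if F: "F \<in> Z" and v: "v \<in> F" for F v
  proof (rule ccontr)
    assume neg: "\<not> (\<exists>w. w \<notin> F \<and> insert w (F - {v}) \<in> Z)"
    let ?G = "F - {v}"
    let ?I = "{u. u \<notin> ?G \<and> insert u ?G \<in> K}"
    let ?t = "\<lambda>u. (-1) ^ card {x \<in> ?G. x < u} * c (insert u ?G)"
    have "finite (\<Union>K)" using K by (simp add: simplicial_complex_def)
    moreover have "?I \<subseteq> \<Union>K" by blast
    ultimately have "finite ?I" by (rule finite_subset[rotated])
    moreover have "v \<in> ?I" using F v ZK by (auto simp: insert_absorb)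
    ultimately have "sum ?t ?I = ?t v + sum ?t (?I - {v})" by (rule sum.remove)
    moreover have "sum ?t (?I - {v}) = 0"
      using neg by (intro sum.neutral) (auto simp: Z_def)
    moreover have "sum ?t ?I = 0" using c(2)[of ?G] by (simp add: bd_def)
    ultimately have "?t v = 0" by simp
    then have "c F = 0" using v by (simp add: insert_absorb)
    then show False using F by (simp add: Z_def)
  qed
  ultimately have "closed_family (d + 1) Z" by (auto simp: closed_family_def)
  with ZK show thesis by (rule that)
qed

section \<open>The lower bound\<close>

lemma join_link_subset:
  assumes "simplicial_complex K"
  shows "join (Pow H) (link K H) \<subseteq> K"
proof
  fix F assume "F \<in> join (Pow H) (link K H)"
  then obtain A B where "F = A \<union> B" "A \<subseteq> H" "B \<union> H \<in> K"
    by (auto simp: join_def link_def)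
  then have "F \<subseteq> B \<union> H" "B \<union> H \<in> K" by blast+
  then show "F \<in> K" using assms by (simp add: simplicial_complex_def)
qed

lemma face_poly_join_link:
  assumes K: "simplicial_complex K" and H: "finite H" and L: "\<forall>A\<in>L. A \<subseteq> H"
  shows "face_poly (join L (link K H)) = face_poly L * face_poly (link K H)"
proof (rule face_poly_join)
  show "\<forall>A\<in>L. finite A" using H L finite_subset by blast
  show "\<forall>B\<in>link K H. finite B"
    using simplicial_complex_link[OF K] by (simp add: simplicial_complex_def)
  show "\<Union>L \<inter> \<Union>(link K H) = {}" using L by (auto simp: link_def)
qed

text \<open>Faces are sorted by their trace on M. Each proper subset A of M contributes at least
  x^|A| * B, and the x^|A| sum to the face polynomial of the boundary of M.\<close>

lemma face_poly_ge_missing_face: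
  assumes K: "simplicial_complex K" and M: "missing_face K M" "card M = Suc n"
    and B: "\<And>v. v \<in> M \<Longrightarrow> coeff_le B (face_poly (link K (M - {v})))"
  shows "coeff_le (simplex_boundary_poly n * B) (face_poly K)"
proof -
  have finM: "finite M" using M by (simp add: missing_face_def)
  have finK: "finite K" using K by (simp add: simplicial_complex_def)
  define P where "P A = {F \<in> K. F \<inter> M = A}" for A
  have *: "coeff_le (monom 1 (card A) * B) (face_poly (P A))" if A: "A \<in> bdry_simplex M" for A
  proof -
    obtain v where v: "v \<in> M" "A \<subseteq> M - {v}" using A by (auto simp: bdry_simplex_def)
    let ?L = "link K (M - {v})"
    have "join {A} ?L \<subseteq> P A"
    proof
      fix F assume "F \<in> join {A} ?L"
      then obtain G where G: "F = A \<union> G" "G \<inter> (M - {v}) = {}" "G \<union> (M - {v}) \<in> K"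
        by (auto simp: join_def link_def)
      \<comment> \<open>Hence G misses all of M, and the trace of A \<union> G is exactly A.\<close>
      have "v \<notin> G"
      proof
        assume "v \<in> G"
        then have "M \<subseteq> G \<union> (M - {v})" by blast
        then show False using G K M by (auto simp: simplicial_complex_def missing_face_def)
      qed
      then have "F \<inter> M = A" using G v by blast
      moreover have "F \<subseteq> G \<union> (M - {v})" using G v by blast
      then have "F \<in> K" using G K by (auto simp: simplicial_complex_def)
      ultimately show "F \<in> P A" by (simp add: P_def)
    qed
    then have "coeff_le (face_poly (join {A} ?L)) (face_poly (P A))"
      using finK by (intro face_poly_mono) (simp_all add: P_def)
    moreover have "face_poly (join {A} ?L) = monom 1 (card A) * face_poly ?L"
      using face_poly_join_link[OF K, of "M - {v}" "{A}"] finM v by simp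
    ultimately show ?thesis
      using coeff_le_mult_left[OF B[OF v(1)]] coeff_le_trans by metis
  qed
  have finbd: "finite (bdry_simplex M)"
    using finM by (rule finite_bdry_simplex)
  have "simplex_boundary_poly n * B = (\<Sum>A\<in>bdry_simplex M. monom 1 (card A) * B)"
    using face_poly_bdry_simplex[OF finM M(2)] by (simp add: face_poly_def flip: sum_distrib_right)
  also have "coeff_le \<dots> (\<Sum>A\<in>bdry_simplex M. face_poly (P A))"
    using * by (rule coeff_le_sum)
  also have "(\<Sum>A\<in>bdry_simplex M. face_poly (P A)) = face_poly (\<Union>A\<in>bdry_simplex M. P A)"
    unfolding face_poly_def using finK finbd
    by (subst sum.UNION_disjoint) (auto simp: P_def)
  also have "coeff_le \<dots> (face_poly K)"
    using finK by (intro face_poly_mono) (auto simp: P_def)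
  finally show ?thesis .
qed

text \<open>Since \<open>insert v H\<close> is a nonface, v is not a vertex of the link of H. So the
  join of that link with the simplex H avoids v and is disjoint from the faces through v.\<close>

lemma face_poly_ge_vertex:
  assumes K: "simplicial_complex K" and H: "finite H" "v \<notin> H" "insert v H \<notin> K"
  shows "coeff_le ([:1, 1:] ^ card H * face_poly (link K H) + monom 1 1 * face_poly (link K {v}))
           (face_poly K)"
proof -
  let ?P = "join (Pow H) (link K H)" and ?Q = "join {{v}} (link K {v})"
  have fin: "finite K" "finite (link K H)" "finite (link K {v})"
    using K simplicial_complex_link[OF K] by (auto simp: simplicial_complex_def)
  have "v \<notin> F" if F: "F \<in> ?P" for F
  proof
    assume "v \<in> F"
    then obtain G where G: "v \<in> G" "G \<union> H \<in> K" using F H by (auto simp: join_def link_def)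
    then have "insert v H \<subseteq> G \<union> H" by blast
    then show False using G H K by (auto simp: simplicial_complex_def)
  qed
  moreover have "v \<in> F" if "F \<in> ?Q" for F using that by (auto simp: join_def)
  ultimately have "?P \<inter> ?Q = {}" by blast
  then have "face_poly (?P \<union> ?Q) = face_poly ?P + face_poly ?Q"
    using fin H by (intro face_poly_Un_disjoint finite_join) auto
  moreover have "?Q \<subseteq> K" by (auto simp: join_def link_def)
  then have "coeff_le (face_poly (?P \<union> ?Q)) (face_poly K)"
    using fin join_link_subset[OF K] by (intro face_poly_mono) auto
  ultimately show ?thesis
    using face_poly_join_link[OF K H(1), of "Pow H"] face_poly_join_link[OF K, of "{v}" "{{v}}"] H
    by (simp add: face_poly_Pow)
qed

text \<open>Exchange v in a member G for w. For dimension reasons \<open>insert w G\<close> is a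
  nonface; a missing face inside it contains v, as F = \<open>insert w (G - {v})\<close> is a face.
  G witnesses that v lies below Z.\<close>

lemma exists_missing_face_at_facet:
  assumes K: "supports_cycle n D K Z" and "0 < D"
  obtains v M F where "v \<in> M" "missing_face K M" "F \<in> Z" "M - {v} \<subseteq> F" "v \<notin> F"
    "\<exists>G\<in>Z. v \<in> G"
proof -
  have sc: "simplicial_complex K" and ZK: "Z \<subseteq> K" and Z: "closed_family D Z"
    and dim: "\<forall>F\<in>K. card F \<le> D" using K by (auto simp: supports_cycle_def)
  obtain G where G: "G \<in> Z" "card G = D" using Z by (auto simp: closed_family_def)
  then obtain v where v: "v \<in> G" using assms(2) by fastforce
  then obtain w where w: "w \<notin> G" "insert w (G - {v}) \<in> Z"
    using Z G by (auto simp: closed_family_def)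
  have fin: "finite G" using sc G ZK by (auto simp: simplicial_complex_def)
  have "insert w G \<notin> K" using dim w G fin by fastforce
  then obtain M where M: "M \<subseteq> insert w G" "missing_face K M"
    using nonface_contains_missing_face[of "insert w G"] fin by blast
  have "v \<in> M"
  proof (rule ccontr)
    assume "v \<notin> M"
    then have "M \<subseteq> insert w (G - {v})" using M by blast
    then have "M \<in> K" using w ZK sc by (auto simp: simplicial_complex_def)
    then show False using M by (simp add: missing_face_def)
  qed
  then show thesis using M w v G by (intro that[of v M "insert w (G - {v})"]) auto
qed

text \<open>The outer induction lowers the bound on missing faces; the inner one, on the number of
  faces with Z fixed, pays for deletions.\<close>

lemma face_poly_ge_step:
  fixes B :: "nat poly"
  assumes base: "\<And>K Z :: 'a set set. supports_cycle i e K Z \<Longrightarrow> coeff_le B (face_poly K)"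
    and "n \<le> i" "supports_cycle n (e + n) (K :: 'a set set) Z"
  shows "coeff_le (simplex_boundary_poly n * B) (face_poly K)"
  using assms(2,3)
proof (induction n arbitrary: K Z)
  case 0
  then show ?case using base supports_cycle_mono by fastforce
next
  case (Suc n)
  from Suc.prems(2) show ?case
  proof (induction "card K" arbitrary: K rule: less_induct)
    case (less K)
    let ?n = "Suc n"
    have sc: "simplicial_complex K" and ZK: "Z \<subseteq> K"
      using less.prems by (auto simp: supports_cycle_def)
    then have finK: "finite K" and fin: "\<forall>F\<in>K. finite F" by (auto simp: simplicial_complex_def)
    have link_bound: "coeff_le B (face_poly (link K H))"
      if H: "H \<subseteq> F" "F \<in> Z" "card H = ?n" for H F
    proof -
      obtain Z' where "supports_cycle ?n e (link K H) Z'"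
        using supports_cycle_link[OF less.prems H(1,2)] H(3) by auto
      then show ?thesis using base supports_cycle_mono Suc.prems(1) by blast
    qed
    consider (free) "\<exists>T\<in>K. card T \<le> ?n + 1 \<and> (\<forall>F\<in>Z. \<not> T \<subseteq> F)"
      | (large) "\<forall>T\<in>K. card T \<le> ?n + 1 \<longrightarrow> (\<exists>F\<in>Z. T \<subseteq> F)"
          "\<exists>M. missing_face K M \<and> card M = Suc ?n"
      | (small) "\<forall>M. missing_face K M \<longrightarrow> card M \<noteq> Suc ?n" by blast
    then show ?case
    proof cases
      case free
      then obtain T where T: "T \<in> K" "card T \<le> ?n + 1" "\<forall>F\<in>Z. \<not> T \<subseteq> F" by blast
      let ?K = "{F \<in> K. \<not> T \<subseteq> F}"
      have "?K \<subset> K" using T(1) by blast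
      then have "card ?K < card K" using finK by (rule psubset_card_mono[rotated])
      then have "coeff_le (simplex_boundary_poly ?n * B) (face_poly ?K)"
        using supports_cycle_deletion[OF less.prems T(2,3)] by (rule less.hyps)
      also have "coeff_le (face_poly ?K) (face_poly K)"
        using finK by (intro face_poly_mono) auto
      finally show ?thesis .
    next
      case large
      from large(2) obtain M where M: "missing_face K M" "card M = Suc ?n" by blast
      show ?thesis
      proof (rule face_poly_ge_missing_face[OF sc M])
        fix v assume v: "v \<in> M"
        then have "M - {v} \<in> K" "card (M - {v}) = ?n"
          using M by (auto simp: missing_face_def)
        then show "coeff_le B (face_poly (link K (M - {v})))"
          using large(1) link_bound by fastforce
      qed
    next
      case small
      \<comment> \<open>The bound on missing faces drops by one while the dimension stays; the link
        of v will lower the dimension to match the outer induction hypothesis.\<close>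
      have supp: "supports_cycle n (e + ?n) K Z"
      proof -
        have "card M \<le> n + 1" if "missing_face K M" for M
        proof -
          have "card M \<le> ?n + 1" "card M \<noteq> Suc ?n"
            using that small less.prems by (auto simp: supports_cycle_def)
          then show ?thesis by simp
        qed
        then show ?thesis using less.prems by (simp add: supports_cycle_def)
      qed
      obtain v M F where M: "v \<in> M" "missing_face K M" "F \<in> Z" "M - {v} \<subseteq> F" "v \<notin> F"
        and v: "\<exists>G\<in>Z. v \<in> G"
        by (rule exists_missing_face_at_facet[OF supp]) simp
      have finF: "finite F" and cardF: "card F = e + ?n"
        using M ZK fin supp by (auto simp: supports_cycle_def closed_family_def)
      have "card M \<le> n + 1" using M supp by (auto simp: supports_cycle_def)
      then have "card (M - {v}) \<le> ?n" by (simp add: card_Diff_subset M(1))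
      \<comment> \<open>Such an H exists because M - v has at most \<open>?n\<close> vertices and F
        has e + \<open>?n\<close>. Its link then has exactly the dimension for which B is a
        bound.\<close>
      then obtain H where H: "M - {v} \<subseteq> H" "H \<subseteq> F" "card H = ?n"
        using exists_subset_between[of "M - {v}" ?n F] finF cardF M(4) by auto
      have "insert v H \<notin> K"
      proof
        assume "insert v H \<in> K"
        moreover have "M \<subseteq> insert v H" using H by blast
        ultimately show False using M sc by (auto simp: simplicial_complex_def missing_face_def)
      qed
      then have split: "coeff_le ([:1, 1:] ^ ?n * face_poly (link K H)
          + monom 1 1 * face_poly (link K {v})) (face_poly K)"
        using face_poly_ge_vertex[OF sc, of H v] H(2,3) M(5) finF
        by (auto simp del: power_Suc dest: finite_subset)
      obtain Z' where "supports_cycle n (e + n) (link K {v}) Z'"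
        using v supports_cycle_link[OF supp, of "{v}"] by auto
      then have "coeff_le (simplex_boundary_poly n * B) (face_poly (link K {v}))"
        using Suc.IH Suc.prems(1) by simp
      then have "coeff_le ([:1, 1:] ^ ?n * B + monom 1 1 * (simplex_boundary_poly n * B))
          ([:1, 1:] ^ ?n * face_poly (link K H) + monom 1 1 * face_poly (link K {v}))"
        using link_bound[OF H(2) M(3) H(3)] by (intro coeff_le_add coeff_le_mult_left)
      also have "[:1, 1:] ^ ?n * B + monom 1 1 * (simplex_boundary_poly n * B)
          = simplex_boundary_poly ?n * B"
        by (simp add: distrib_right mult.assoc del: power_Suc)
      finally show ?thesis using split coeff_le_trans by blast
    qed
  qed
qed

text \<open>For m = 0 the empty face suffices. Each further factor comes from the step with n = i
  and e = m * i, the induction hypothesis serving as its base bound.\<close>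

lemma face_poly_ge_power:
  fixes K :: "'a set set"
  assumes "supports_cycle i (m * i) K Z"
  shows "coeff_le (simplex_boundary_poly i ^ m) (face_poly K)"
  using assms
proof (induction m arbitrary: K Z)
  case 0
  then have sc: "simplicial_complex K" and "K \<noteq> {}"
    by (auto simp: supports_cycle_def closed_family_def)
  then have "finite K" "{{}} \<subseteq> K" by (auto simp: simplicial_complex_def)
  then have "coeff_le (face_poly {{} :: 'a set}) (face_poly K)" by (rule face_poly_mono)
  then show ?case by (simp add: monom_0 one_pCons)
next
  case (Suc m)
  have "coeff_le (simplex_boundary_poly i * simplex_boundary_poly i ^ m) (face_poly K)"
    using Suc.prems by (intro face_poly_ge_step[OF Suc.IH, of i]) (auto simp: add.commute)
  then show ?case by simp
qed

theorem theorem1p1: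
  fixes \<Delta> :: "'a::linorder set set" and d i :: nat
  assumes "0 < i" and "i \<le> d + 1" and "i dvd d + 1"
    and "\<Delta> \<in> Cfam i d"
  shows "\<forall>j. fvec j \<Delta> \<ge> fvec j (S_sphere i d)"
proof -
  obtain m where m: "d + 1 = m * i" using assms(3) by (metis dvd_def mult.commute)
  have sc: "simplicial_complex \<Delta>" using assms(4) by (simp add: Cfam_def)
  obtain Z where "Z \<subseteq> \<Delta>" "closed_family (d + 1) Z"
    using nonzero_homology_closed_family[OF sc] assms(4) by (auto simp: Cfam_def)
  \<comment> \<open>The truncated condition \<open>card F - 1 \<le> i\<close> is equivalent to
    \<open>card F \<le> i + 1\<close>, also for the empty set.\<close>
  then have "supports_cycle i (m * i) \<Delta> Z"
    using assms(4) unfolding m[symmetric]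
    by (auto simp: supports_cycle_def Cfam_def has_dim_def le_diff_conv)
  then have "coeff_le (face_poly (S_sphere i d)) (face_poly \<Delta>)"
    using face_poly_ge_power face_poly_S_sphere[OF assms(1) m] by metis
  moreover have "finite \<Delta>" using sc by (simp add: simplicial_complex_def)
  ultimately show ?thesis
    by (auto simp: coeff_le_def fvec_def coeff_face_poly finite_S_sphere)
qed

end
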